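(* Let $\leq$ be a linear order on a set $X$ and let $R:=R_{\leq}$ be the corresponding circular order on $X$. Then: (1) Always $\lambda_R\subseteq\lambda_{\leq}$. (2) $\lambda_R=\lambda_{\leq}$ if and only if one of the following conditions is satisfied: (a) $(X,\leq)$ has both a minimum $u$ and a maximum $v$ (so $X=[u,v]$); (b) $(X,\leq)$ has neither a minimum nor a maximum. (3) $\lambda_R\neq\lambda_{\leq}$ if and only if one of the following conditions is satisfied: (a) $(X,\leq)$ has a minimum but no maximum; (b) $(X,\leq)$ has a maximum but no minimum.
   Context: A circular order on a set $X$ is a ternary relation $R\subseteq X^3$ (write $[a,b,c]$ for $(a,b,c)\in R$) satisfying: cyclicity ($[a,b,c]\Rightarrow[b,c,a]$); asymmetry ($[a,b,c]\Rightarrow (c,b,a)\notin R$); transitivity ($[a,b,c]$ and $[a,c,d]$ imply $[a,b,d]$); totality (if $a,b,c$ are distinct then $[a,b,c]$ or $[a,c,b]$). Put $(a,b)_R:=\{x\in X:[a,x,b]\}$ and $[a,b]_R:=(a,b)_R\cup\{a,b\}$. The interval topology $\lambda_R$ is the topology on $X$ with base $\{X\setminus[a,b]_R: a,b\in X\}\cup\{X\}$. The interval topology $\lambda_{\leq}$ of a linear order $\leq$ on $X$ is generated by the subbase of all rays $(a,\to)=\{x:a<x\}$ and $(\leftarrow,b)=\{x:x<b\}$, $a,b\in X$ (together with $X$). Every linear order $\leq$ on $X$ defines a circular order $R_{\leq}$: $[x,y,z]$ iff $x<y<z$ or $y<z<x$ or $z<x<y$. *)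

theory Defs
  imports "HOL-Analysis.Analysis"
begin

definition circular_order_on :: "'a set \<Rightarrow> ('a \<times> 'a \<times> 'a) set \<Rightarrow> bool" where
  "circular_order_on X R \<longleftrightarrow>
     R \<subseteq> X \<times> X \<times> X \<and>
     (\<forall>a b c. (a, b, c) \<in> R \<longrightarrow> (b, c, a) \<in> R) \<and>
     (\<forall>a b c. (a, b, c) \<in> R \<longrightarrow> (c, b, a) \<notin> R) \<and>
     (\<forall>a b c d. (a, b, c) \<in> R \<and> (a, c, d) \<in> R \<longrightarrow> (a, b, d) \<in> R) \<and>
     (\<forall>a\<in>X. \<forall>b\<in>X. \<forall>c\<in>X. a \<noteq> b \<and> b \<noteq> c \<and> a \<noteq> c \<longrightarrow> (a, b, c) \<in> R \<or> (a, c, b) \<in> R)"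

definition circ_open_interval :: "'a set \<Rightarrow> ('a \<times> 'a \<times> 'a) set \<Rightarrow> 'a \<Rightarrow> 'a \<Rightarrow> 'a set" where
  "circ_open_interval X R a b = {x \<in> X. (a, x, b) \<in> R}"

definition circ_closed_interval :: "'a set \<Rightarrow> ('a \<times> 'a \<times> 'a) set \<Rightarrow> 'a \<Rightarrow> 'a \<Rightarrow> 'a set" where
  "circ_closed_interval X R a b = circ_open_interval X R a b \<union> {a, b}"

definition circ_base :: "'a set \<Rightarrow> ('a \<times> 'a \<times> 'a) set \<Rightarrow> 'a set set" where
  "circ_base X R = {X - circ_closed_interval X R a b | a b. a \<in> X \<and> b \<in> X} \<union> {X}"

text \<open>The open sets are exactly the unions of members of \<^const>\<open>circ_base\<close>; that these do form a
  topology when \<open>R\<close> is a circular order is lemma \<open>openin_circ_topology\<close> below.\<close>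

definition circ_topology :: "'a set \<Rightarrow> ('a \<times> 'a \<times> 'a) set \<Rightarrow> 'a topology" where
  "circ_topology X R = topology (arbitrary union_of (\<lambda>U. U \<in> circ_base X R))"

text \<open>Linear orders on \<open>X\<close> are reflexive relations \<open>r\<close> with \<^term>\<open>linear_order_on X r\<close>, so
  \<open>x < y\<close> is rendered as \<^term>\<open>(x, y) \<in> r - Id\<close>.\<close>

definition order_topology_on :: "'a set \<Rightarrow> 'a rel \<Rightarrow> 'a topology" where
  "order_topology_on X r = topology_generated_by
     ({{x \<in> X. (a, x) \<in> r - Id} | a. a \<in> X} \<union> {{x \<in> X. (x, b) \<in> r - Id} | b. b \<in> X} \<union> {X})"

definition circ_of_linear :: "'a rel \<Rightarrow> ('a \<times> 'a \<times> 'a) set" where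
  "circ_of_linear r = {(x, y, z).
     ((x, y) \<in> r - Id \<and> (y, z) \<in> r - Id) \<or>
     ((y, z) \<in> r - Id \<and> (z, x) \<in> r - Id) \<or>
     ((z, x) \<in> r - Id \<and> (x, y) \<in> r - Id)}"

definition is_minimum_on :: "'a set \<Rightarrow> 'a rel \<Rightarrow> 'a \<Rightarrow> bool" where
  "is_minimum_on X r u \<longleftrightarrow> u \<in> X \<and> (\<forall>x\<in>X. (u, x) \<in> r)"

definition is_maximum_on :: "'a set \<Rightarrow> 'a rel \<Rightarrow> 'a \<Rightarrow> bool" where
  "is_maximum_on X r v \<longleftrightarrow> v \<in> X \<and> (\<forall>x\<in>X. (x, v) \<in> r)"

lemma circular_order_on_circ_of_linear:
  assumes "linear_order_on X r"
  shows "circular_order_on X (circ_of_linear r)"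
proof -
  have sub: "r \<subseteq> X \<times> X" and tr: "\<And>x y z. (x, y) \<in> r \<Longrightarrow> (y, z) \<in> r \<Longrightarrow> (x, z) \<in> r"
    and as: "\<And>x y. (x, y) \<in> r \<Longrightarrow> (y, x) \<in> r \<Longrightarrow> x = y"
    and tot: "\<And>x y. x \<in> X \<Longrightarrow> y \<in> X \<Longrightarrow> x \<noteq> y \<Longrightarrow> (x, y) \<in> r \<or> (y, x) \<in> r"
    using assms by (auto simp: order_on_defs total_on_def dest: transD antisymD)
  have 1: "circ_of_linear r \<subseteq> X \<times> X \<times> X"
    using sub by (auto simp: circ_of_linear_def)
  have 2: "\<And>a b c. (a, b, c) \<in> circ_of_linear r \<Longrightarrow> (b, c, a) \<in> circ_of_linear r"
    by (auto simp: circ_of_linear_def)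
  have 3: "\<And>a b c. (a, b, c) \<in> circ_of_linear r \<Longrightarrow> (c, b, a) \<notin> circ_of_linear r"
    unfolding circ_of_linear_def by simp (metis as tr)
  have 4: "\<And>a b c d. (a, b, c) \<in> circ_of_linear r \<Longrightarrow> (a, c, d) \<in> circ_of_linear r
      \<Longrightarrow> (a, b, d) \<in> circ_of_linear r"
    unfolding circ_of_linear_def by simp (metis as tr)
  have 5: "\<And>a b c. a \<in> X \<Longrightarrow> b \<in> X \<Longrightarrow> c \<in> X \<Longrightarrow> a \<noteq> b \<and> b \<noteq> c \<and> a \<noteq> c \<Longrightarrow>
      (a, b, c) \<in> circ_of_linear r \<or> (a, c, b) \<in> circ_of_linear r"
    unfolding circ_of_linear_def by simp (metis tot)
  show ?thesis
    unfolding circular_order_on_def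
    by (intro conjI allI impI ballI) (use 1 in blast, erule 2, erule 3, (erule conjE, rule 4, assumption+), rule 5)
qed

lemma istopology_circ_base:
  assumes "circular_order_on X R"
  shows "istopology (arbitrary union_of (\<lambda>U. U \<in> circ_base X R))"
proof -
  have "R \<subseteq> X \<times> X \<times> X"
    using assms unfolding circular_order_on_def by (rule conjunct1)
  then have sub: "a \<in> X \<and> b \<in> X \<and> c \<in> X" if "(a, b, c) \<in> R" for a b c
    using that by auto
  have cyc: "(b, c, a) \<in> R" if "(a, b, c) \<in> R" for a b c
    using assms that unfolding circular_order_on_def by (elim conjE) metis
  have asy: "(c, b, a) \<notin> R" if "(a, b, c) \<in> R" for a b c
    using assms that unfolding circular_order_on_def by (elim conjE) metis
  have tr: "(a, b, d) \<in> R" if "(a, b, c) \<in> R" "(a, c, d) \<in> R" for a b c d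
    using assms that unfolding circular_order_on_def by (elim conjE) metis
  have tot: "(a, b, c) \<in> R \<or> (a, c, b) \<in> R"
    if "a \<in> X" "b \<in> X" "c \<in> X" "a \<noteq> b" "b \<noteq> c" "a \<noteq> c" for a b c
    using assms that unfolding circular_order_on_def by (elim conjE) metis
  let ?C = "circ_closed_interval X R"
  have mem: "\<And>y a b. y \<in> ?C a b \<longleftrightarrow> (a, y, b) \<in> R \<or> y = a \<or> y = b"
    using sub by (auto simp: circ_closed_interval_def circ_open_interval_def)
  have ex: "\<exists>V\<in>circ_base X R. x \<in> V \<and> V \<subseteq> S \<inter> T"
    if S: "S \<in> circ_base X R" and T: "T \<in> circ_base X R" and x: "x \<in> S \<inter> T" for S T x
  proof (cases "S = X \<or> T = X")
    case True
    have "S \<subseteq> X" "T \<subseteq> X" using S T by (auto simp: circ_base_def)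
    then show ?thesis using True S T x by blast
  next
    case False
    then obtain a b c d where abcd: "a \<in> X" "b \<in> X" "c \<in> X" "d \<in> X"
      and S': "S = X - ?C a b" and T': "T = X - ?C c d"
      using S T by (auto simp: circ_base_def)
    \<comment> \<open>the linear order on \<open>X - {x}\<close> obtained from cutting the circle at \<open>x\<close>\<close>
    define le where "le y z \<longleftrightarrow> y = z \<or> (x, y, z) \<in> R" for y z
    have xX: "x \<in> X" and xab: "x \<notin> ?C a b" and xcd: "x \<notin> ?C c d"
      using x S' T' by auto
    have ne: "x \<noteq> a" "x \<noteq> b" "x \<noteq> c" "x \<noteq> d"
      using xab xcd by (auto simp: mem)
    have le_tot: "le y z \<or> le z y" if "y \<in> X" "z \<in> X" "x \<noteq> y" "x \<noteq> z" for y z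
      using tot[of x y z] that xX by (auto simp: le_def)
    have le_tr: "le y w" if "le y z" "le z w" for y z w
      using that tr unfolding le_def by metis
    have C1: "le p y \<and> le y q" if "x \<notin> ?C p q" "p \<in> X" "q \<in> X" and y: "y \<in> ?C p q" for p q y
    proof -
      have n: "x \<noteq> p" "x \<noteq> q" "(p, x, q) \<notin> R" using that by (auto simp: mem)
      have pq: "le p q"
        unfolding le_def using tot[of x p q] n that(2,3) xX cyc by metis
      consider "y = p" | "y = q" | "(p, y, q) \<in> R" using y by (auto simp: mem)
      then show ?thesis
      proof cases
        case 3
        then have "p \<noteq> q" using asy by metis
        then have xpq: "(x, p, q) \<in> R" using pq by (simp add: le_def)
        have "(q, x, y) \<in> R" using tr[of q x p y] cyc xpq 3 by metis
        then have "(x, y, q) \<in> R" using cyc by metis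
        moreover have "(p, y, x) \<in> R" using tr[of p y q x] cyc xpq 3 by metis
        then have "(x, p, y) \<in> R" using cyc by metis
        ultimately show ?thesis by (simp add: le_def)
      qed (use pq in \<open>auto simp: le_def\<close>)
    qed
    have C2: "y \<in> ?C p q" if "le p y" "le y q" for p q y
    proof (cases "y = p \<or> y = q")
      case False
      then have "(x, p, y) \<in> R" "(x, y, q) \<in> R" using that by (auto simp: le_def)
      then have "(y, q, p) \<in> R" using tr[of y q x p] cyc by metis
      then show ?thesis using cyc unfolding mem by metis
    qed (auto simp: mem)
    have C3: "x \<notin> ?C p q" if "le p q" "x \<noteq> p" "x \<noteq> q" for p q
      using that asy cyc unfolding mem le_def by metis
    define p where "p = (if le a c then a else c)"
    define q where "q = (if le b d then d else b)"
    have pq: "p \<in> X" "q \<in> X" "x \<noteq> p" "x \<noteq> q"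
      using abcd ne by (auto simp: p_def q_def)
    have p: "le p a" "le p c" using le_tot[of a c] abcd ne by (auto simp: p_def le_def)
    have q: "le b q" "le d q" using le_tot[of b d] abcd ne by (auto simp: q_def le_def)
    have "le a b" using C1[OF xab abcd(1,2), of a] by (simp add: mem)
    then have "x \<notin> ?C p q" using C3[OF _ pq(3,4)] le_tr[OF p(1)] le_tr[OF _ q(1)] by simp
    moreover have "?C a b \<subseteq> ?C p q"
    proof
      fix y assume "y \<in> ?C a b"
      then have "le a y" "le y b" using C1[OF xab abcd(1,2)] by simp_all
      then show "y \<in> ?C p q" using C2 le_tr p(1) q(1) by metis
    qed
    moreover have "?C c d \<subseteq> ?C p q"
    proof
      fix y assume "y \<in> ?C c d"
      then have "le c y" "le y d" using C1[OF xcd abcd(3,4)] by simp_all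
      then show "y \<in> ?C p q" using C2 le_tr p(2) q(2) by metis
    qed
    ultimately have "x \<in> X - ?C p q" "X - ?C p q \<subseteq> S \<inter> T"
      unfolding S' T' using xX by (simp, blast)
    moreover have "X - ?C p q \<in> circ_base X R"
      using pq(1,2) unfolding circ_base_def by blast
    ultimately show ?thesis by metis
  qed
  show ?thesis
    unfolding istopology_base_eq
  proof (intro allI impI)
    fix S T assume "S \<in> circ_base X R \<and> T \<in> circ_base X R"
    then have "\<Union>{V \<in> circ_base X R. V \<subseteq> S \<inter> T} = S \<inter> T" using ex by blast
    then show "(arbitrary union_of (\<lambda>U. U \<in> circ_base X R)) (S \<inter> T)"
      unfolding union_of_def arbitrary_def
      by (intro exI[of _ "{V \<in> circ_base X R. V \<subseteq> S \<inter> T}"]) auto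
  qed
qed

lemma openin_circ_topology:
  assumes "circular_order_on X R"
  shows "openin (circ_topology X R) U \<longleftrightarrow> (\<exists>\<U>\<subseteq>circ_base X R. \<Union>\<U> = U)"
proof -
  have "openin (circ_topology X R) = arbitrary union_of (\<lambda>U. U \<in> circ_base X R)"
    unfolding circ_topology_def using istopology_circ_base[OF assms] by simp
  then show ?thesis
    by (auto simp: union_of_def arbitrary_def)
qed

end

theory Submission
  imports Defs
begin

text \<open>For \<open>a \<le> b\<close> the complement of \<open>[a,b]\<^sub>R\<close> is the union of the two rays \<open>x < a\<close> and \<open>b < x\<close>,
  and for \<open>b < a\<close> it is the open order interval from \<open>b\<close> to \<open>a\<close>; all these sets are open for the
  linear order. Conversely, a ray \<open>a < x\<close> is the complement of \<open>[u,a]\<^sub>R\<close> if \<open>u\<close> is a minimum, and the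
  union of the open intervals from \<open>a\<close> to \<open>c\<close> if there is no maximum. If \<open>u\<close> is a minimum and there is
  no maximum, then a circularly open set containing \<open>u\<close> contains a final segment, so that \<open>x < b\<close> is
  not circularly open for \<open>b > u\<close>. Reversing the order gives the dual cases.\<close>

text \<open>Reversal only swaps the endpoints of closed circular intervals, and the base ranges over
  all pairs of endpoints. This lets each dual case be read off from the same topology.\<close>

lemma circ_topology_converse:
  "circ_topology X (circ_of_linear (r\<inverse>)) = circ_topology X (circ_of_linear r)"
proof -
  have "circ_closed_interval X (circ_of_linear (r\<inverse>)) a b
      = circ_closed_interval X (circ_of_linear r) b a" for a b
    by (auto simp: circ_closed_interval_def circ_open_interval_def circ_of_linear_def)
  then have "circ_base X (circ_of_linear (r\<inverse>)) = circ_base X (circ_of_linear r)"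
    unfolding circ_base_def by auto
  then show ?thesis
    by (simp add: circ_topology_def)
qed

lemma order_topology_on_converse: "order_topology_on X (r\<inverse>) = order_topology_on X r"
proof -
  have "(x, y) \<in> r\<inverse> - Id \<longleftrightarrow> (y, x) \<in> r - Id" for x y
    by auto
  then show ?thesis
    by (simp only: order_topology_on_def Un_commute)
qed

lemma is_minimum_on_converse: "is_minimum_on X (r\<inverse>) = is_maximum_on X r"
  and is_maximum_on_converse: "is_maximum_on X (r\<inverse>) = is_minimum_on X r"
  by (auto simp: fun_eq_iff is_minimum_on_def is_maximum_on_def)

lemma openin_order_topology_on_rays:
  assumes "a \<in> X"
  shows "openin (order_topology_on X r) {x \<in> X. (a, x) \<in> r - Id}"
    and "openin (order_topology_on X r) {x \<in> X. (x, a) \<in> r - Id}"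
  unfolding order_topology_on_def
  by (rule topology_generated_by_Basis; use assms in blast)+

context
  fixes X :: "'a set" and r :: "'a rel"
  assumes lin: "linear_order_on X r"
begin

lemma in_carrier: "(x, y) \<in> r \<Longrightarrow> x \<in> X" "(x, y) \<in> r \<Longrightarrow> y \<in> X"
  and le_refl: "x \<in> X \<Longrightarrow> (x, x) \<in> r"
  and le_trans: "(x, y) \<in> r \<Longrightarrow> (y, z) \<in> r \<Longrightarrow> (x, z) \<in> r"
  and le_antisym: "(x, y) \<in> r \<Longrightarrow> (y, x) \<in> r \<Longrightarrow> x = y"
  using lin by (auto simp: order_on_defs dest: transD antisymD refl_onD)

lemma le_total: "x \<in> X \<Longrightarrow> y \<in> X \<Longrightarrow> (x, y) \<in> r \<or> (y, x) \<in> r"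
  using lin le_refl by (cases "x = y") (auto simp: order_on_defs total_on_def)

text \<open>The two wrap-around disjuncts of \<open>circ_of_linear\<close> would need
  \<open>b < a\<close>, so only \<open>a < x < b\<close> remains. For \<open>a = b\<close> no
  disjunct holds and the closed interval is \<open>{a}\<close>.\<close>

lemma compl_circ_closed_interval_le:
  assumes "(a, b) \<in> r"
  shows "X - circ_closed_interval X (circ_of_linear r) a b
    = {x \<in> X. (x, a) \<in> r - Id} \<union> {x \<in> X. (b, x) \<in> r - Id}"
proof -
  have "x \<notin> circ_closed_interval X (circ_of_linear r) a b
      \<longleftrightarrow> (x, a) \<in> r - Id \<or> (b, x) \<in> r - Id" if "x \<in> X" for x
    using that assms in_carrier[OF assms]
    unfolding circ_closed_interval_def circ_open_interval_def circ_of_linear_def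
    by simp (metis le_trans le_antisym le_total)
  then show ?thesis by blast
qed

text \<open>Here \<open>a < x < b\<close> is impossible and the wrap-around disjuncts amount to
  \<open>a < x\<close> or \<open>x < b\<close>.\<close>

lemma compl_circ_closed_interval_gt:
  assumes "(b, a) \<in> r - Id"
  shows "X - circ_closed_interval X (circ_of_linear r) a b
    = {x \<in> X. (b, x) \<in> r - Id \<and> (x, a) \<in> r - Id}"
proof -
  have "a \<in> X" "b \<in> X"
    using assms in_carrier by auto
  then have "x \<notin> circ_closed_interval X (circ_of_linear r) a b
      \<longleftrightarrow> (b, x) \<in> r - Id \<and> (x, a) \<in> r - Id" if "x \<in> X" for x
    using that assms
    unfolding circ_closed_interval_def circ_open_interval_def circ_of_linear_def
    by simp (metis le_trans le_antisym le_total)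
  then show ?thesis by blast
qed

lemma openin_circ_of_linear:
  "openin (circ_topology X (circ_of_linear r)) U
    \<longleftrightarrow> (\<exists>\<U>\<subseteq>circ_base X (circ_of_linear r). \<Union>\<U> = U)"
  by (rule openin_circ_topology[OF circular_order_on_circ_of_linear[OF lin]])

lemma openin_compl_circ_closed_interval:
  assumes "a \<in> X" "b \<in> X"
  shows "openin (circ_topology X (circ_of_linear r))
    (X - circ_closed_interval X (circ_of_linear r) a b)"
  unfolding openin_circ_of_linear
  by (rule exI[of _ "{X - circ_closed_interval X (circ_of_linear r) a b}"])
    (use assms in \<open>auto simp: circ_base_def\<close>)

lemma openin_order_topology_on_if_circ:
  assumes "openin (circ_topology X (circ_of_linear r)) U"
  shows "openin (order_topology_on X r) U"
proof -
  let ?T = "order_topology_on X r"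
  have X: "openin ?T X"
    unfolding order_topology_on_def by (rule topology_generated_by_Basis) blast
  have "openin ?T (X - circ_closed_interval X (circ_of_linear r) a b)"
    if ab: "a \<in> X" "b \<in> X" for a b
  proof (cases "(a, b) \<in> r")
    case True
    then show ?thesis
      unfolding compl_circ_closed_interval_le[OF True]
      by (intro openin_Un openin_order_topology_on_rays ab)
  next
    case False
    then have "(b, a) \<in> r - Id"
      using ab le_total le_refl by auto
    moreover have "{x \<in> X. (b, x) \<in> r - Id \<and> (x, a) \<in> r - Id}
        = {x \<in> X. (b, x) \<in> r - Id} \<inter> {x \<in> X. (x, a) \<in> r - Id}"
      by blast
    ultimately show ?thesis
      by (simp only: compl_circ_closed_interval_gt openin_Int openin_order_topology_on_rays ab)
  qed
  with X have "openin ?T V" if "V \<in> circ_base X (circ_of_linear r)" for V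
    using that by (auto simp: circ_base_def)
  then show ?thesis
    using assms unfolding openin_circ_of_linear by blast
qed

lemma openin_circ_upper_ray_if_minimum:
  assumes u: "is_minimum_on X r u" and a: "a \<in> X"
  shows "openin (circ_topology X (circ_of_linear r)) {x \<in> X. (a, x) \<in> r - Id}"
proof -
  have ua: "u \<in> X" "(u, a) \<in> r"
    using u a by (auto simp: is_minimum_on_def)
  have "{x \<in> X. (x, u) \<in> r - Id} = {}"
    using u le_antisym by (auto simp: is_minimum_on_def)
  then show ?thesis
    using openin_compl_circ_closed_interval[OF ua(1) a] compl_circ_closed_interval_le[OF ua(2)]
    by (simp only: Un_empty_left)
qed

lemma openin_circ_upper_ray_if_no_maximum:
  assumes nv: "\<nexists>v. is_maximum_on X r v" and a: "a \<in> X"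
  shows "openin (circ_topology X (circ_of_linear r)) {x \<in> X. (a, x) \<in> r - Id}"
proof (subst openin_subopen, intro ballI)
  fix x assume "x \<in> {x \<in> X. (a, x) \<in> r - Id}"
  then have x: "x \<in> X" "(a, x) \<in> r - Id" by auto
  obtain c where c: "(x, c) \<in> r - Id"
    using nv x(1) le_total le_refl unfolding is_maximum_on_def by (metis DiffI pair_in_Id_conv)
  have "c \<in> X" using c in_carrier by auto
  have ac: "(a, c) \<in> r - Id"
    using x(2) c le_trans le_antisym by (metis DiffD1 DiffD2 DiffI pair_in_Id_conv)
  show "\<exists>T. openin (circ_topology X (circ_of_linear r)) T \<and> x \<in> T
      \<and> T \<subseteq> {x \<in> X. (a, x) \<in> r - Id}"
    \<comment> \<open>The endpoints are in descending order, so the complement is the order interval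
      from \<open>a\<close> to \<open>c\<close>, a neighbourhood of \<open>x\<close> inside the
      ray.\<close>
    using openin_compl_circ_closed_interval[OF \<open>c \<in> X\<close> a] x c
    unfolding compl_circ_closed_interval_gt[OF ac] by blast
qed

lemma circ_topology_neq_if_minimum_no_maximum:
  assumes u: "is_minimum_on X r u" and nv: "\<nexists>v. is_maximum_on X r v"
  shows "circ_topology X (circ_of_linear r) \<noteq> order_topology_on X r"
proof
  assume eq: "circ_topology X (circ_of_linear r) = order_topology_on X r"
  have uX: "u \<in> X" and umin: "\<And>x. x \<in> X \<Longrightarrow> (u, x) \<in> r"
    using u by (auto simp: is_minimum_on_def)
  have gt: "\<exists>c. (x, c) \<in> r - Id" if "x \<in> X" for x
    using nv that le_total le_refl unfolding is_maximum_on_def by (metis DiffI pair_in_Id_conv)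
  \<comment> \<open>The ray below \<open>b\<close> will be the set that is open for the order but
    not circularly open.\<close>
  obtain b where b: "(u, b) \<in> r - Id" using gt[OF uX] by blast
  then have bX: "b \<in> X" and ub: "u \<in> {x \<in> X. (x, b) \<in> r - Id}"
    using in_carrier(2) uX by blast+
  have "openin (circ_topology X (circ_of_linear r)) {x \<in> X. (x, b) \<in> r - Id}"
    unfolding eq by (rule openin_order_topology_on_rays[OF bX])
  then obtain \<U> where \<U>: "\<U> \<subseteq> circ_base X (circ_of_linear r)"
    and UU: "\<Union>\<U> = {x \<in> X. (x, b) \<in> r - Id}"
    unfolding openin_circ_of_linear by (elim exE conjE)
  obtain V where "V \<in> \<U>" "u \<in> V"
    using ub unfolding UU[symmetric] by (elim UnionE)
  then have V: "V \<in> circ_base X (circ_of_linear r)" "u \<in> V"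
    and Vsub: "V \<subseteq> {x \<in> X. (x, b) \<in> r - Id}"
    using \<U> unfolding UU[symmetric] by blast+
  have "V \<noteq> X" using Vsub bX by blast
  then obtain c d where cd: "c \<in> X" "d \<in> X"
    and Veq: "V = X - circ_closed_interval X (circ_of_linear r) c d"
    using V(1) by (auto simp: circ_base_def)
  \<comment> \<open>Otherwise \<open>V\<close> would be the order interval from \<open>d\<close> to
    \<open>c\<close>, and \<open>u\<close> in \<open>V\<close> would lie strictly above
    \<open>d\<close>.\<close>
  have "(c, d) \<in> r"
  proof (rule ccontr)
    assume "(c, d) \<notin> r"
    then have dc: "(d, c) \<in> r - Id" using cd le_total le_refl by auto
    have "(d, u) \<in> r - Id"
      using V(2) unfolding Veq compl_circ_closed_interval_gt[OF dc] by blast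
    then show False using umin[OF cd(2)] le_antisym by auto
  qed
  then have "V = {x \<in> X. (x, c) \<in> r - Id} \<union> {x \<in> X. (d, x) \<in> r - Id}"
    unfolding Veq by (rule compl_circ_closed_interval_le)
  then have final: "x \<in> V" if "(d, x) \<in> r - Id" for x
    using that in_carrier(2) by blast
  \<comment> \<open>An element \<open>e\<close> strictly above both \<open>d\<close> and
    \<open>b\<close> lies in the final segment contained in \<open>V\<close>, yet not in the ray
    below \<open>b\<close>.\<close>
  obtain m where m: "(d, m) \<in> r" "(b, m) \<in> r"
    using le_total[OF cd(2) bX] le_refl cd bX by blast
  obtain e where e: "(m, e) \<in> r - Id" using gt in_carrier(2)[OF m(1)] by blast
  have "(b, e) \<in> r" "(d, e) \<in> r" "d \<noteq> e"
    using m e le_trans[of _ m e] le_antisym[of e m] by blast+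
  moreover from this have "(e, b) \<in> r - Id"
    using final Vsub by blast
  ultimately show False using le_antisym by blast
qed

end

text \<open>By \<open>bounds\<close>, there is a minimum or there is no maximum, so one of the two
  ray lemmas gives the upper rays. The assumption is symmetric under reversal, which gives the lower
  rays.\<close>

lemma circ_topology_eq_order_topology_onI:
  assumes lin: "linear_order_on X r"
    and bounds: "(\<exists>u. is_minimum_on X r u) \<longleftrightarrow> (\<exists>v. is_maximum_on X r v)"
  shows "circ_topology X (circ_of_linear r) = order_topology_on X r"
proof -
  let ?T = "circ_topology X (circ_of_linear r)"
  have lin': "linear_order_on X (r\<inverse>)"
    using lin by simp
  have up: "openin ?T {x \<in> X. (a, x) \<in> r - Id}" if "a \<in> X" for a
    using openin_circ_upper_ray_if_minimum[OF lin _ that]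
      openin_circ_upper_ray_if_no_maximum[OF lin _ that] bounds
    by blast
  have "openin ?T {x \<in> X. (b, x) \<in> r\<inverse> - Id}" if "b \<in> X" for b
    using openin_circ_upper_ray_if_minimum[OF lin' _ that]
      openin_circ_upper_ray_if_no_maximum[OF lin' _ that] bounds
    unfolding circ_topology_converse is_minimum_on_converse is_maximum_on_converse
    by blast
  moreover have "(b, x) \<in> r\<inverse> - Id \<longleftrightarrow> (x, b) \<in> r - Id" for b x
    by auto
  ultimately have down: "openin ?T {x \<in> X. (x, b) \<in> r - Id}" if "b \<in> X" for b
    using that by (simp only:)
  have whole: "openin ?T X"
    unfolding openin_circ_of_linear[OF lin] by (rule exI[of _ "{X}"]) (simp add: circ_base_def)
  have "openin ?T U" if "openin (order_topology_on X r) U" for U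
    using openin_topology_generated_by[OF that[unfolded order_topology_on_def]]
    \<comment> \<open>The generated topology is the coarsest one in which the subbase is open, so
      checking rays and \<open>X\<close> suffices.\<close>
    by (rule generate_topology_on_coarsest[OF istopology_openin, rotated])
      (use up down whole in auto)
  then show ?thesis
    using openin_order_topology_on_if_circ[OF lin] by (auto simp: topology_eq)
qed

text \<open>If the equivalence fails, exactly one bound exists, and the topologies differ by the
  minimum case for \<open>r\<close> or for its converse.\<close>

lemma circ_topology_eq_order_topology_on_iff:
  assumes lin: "linear_order_on X r"
  shows "circ_topology X (circ_of_linear r) = order_topology_on X r
    \<longleftrightarrow> ((\<exists>u. is_minimum_on X r u) \<longleftrightarrow> (\<exists>v. is_maximum_on X r v))"
proof -
  have "linear_order_on X (r\<inverse>)"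
    using lin by simp
  from circ_topology_neq_if_minimum_no_maximum[OF this]
  show ?thesis
    using circ_topology_neq_if_minimum_no_maximum[OF lin]
      circ_topology_eq_order_topology_onI[OF lin]
    unfolding circ_topology_converse order_topology_on_converse
      is_minimum_on_converse is_maximum_on_converse
    by blast
qed

theorem lemma3p4:
  fixes X :: "'a set" and r :: "'a rel" and R :: "('a \<times> 'a \<times> 'a) set"
  assumes "linear_order_on X r"
    and "R = circ_of_linear r"
  shows "Collect (openin (circ_topology X R)) \<subseteq> Collect (openin (order_topology_on X r)) \<and>
         (circ_topology X R = order_topology_on X r \<longleftrightarrow>
           ((\<exists>u. is_minimum_on X r u) \<and> (\<exists>v. is_maximum_on X r v)) \<or>
           ((\<nexists>u. is_minimum_on X r u) \<and> (\<nexists>v. is_maximum_on X r v))) \<and>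
         (circ_topology X R \<noteq> order_topology_on X r \<longleftrightarrow>
           ((\<exists>u. is_minimum_on X r u) \<and> (\<nexists>v. is_maximum_on X r v)) \<or>
           ((\<exists>v. is_maximum_on X r v) \<and> (\<nexists>u. is_minimum_on X r u)))"
  unfolding assms(2)
  using openin_order_topology_on_if_circ[OF assms(1)]
    circ_topology_eq_order_topology_on_iff[OF assms(1)]
  by blast

end
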